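(* The star combinatory calculus for arithmetic has the Church–Rosser property: each term has a unique normal form.
   Context: Star combinatory calculus for arithmetic: types are generated from the ground type $N$ by $\sigma\to\tau$ and $\sigma^*$. Constants: $0:N$, $S:N\to N$, $R_\sigma:N\to\sigma\to(\sigma\to N\to\sigma)\to\sigma$; $\Pi_{\sigma,\tau}:\sigma\to\tau\to\sigma$; $\Sigma_{\rho,\sigma,\tau}:(\rho\to\sigma\to\tau)\to(\rho\to\sigma)\to\rho\to\tau$; $\mathfrak{s}_\sigma:\sigma\to\sigma^*$; $\cup_\sigma:\sigma^*\to\sigma^*\to\sigma^*$; $\bigcup_{\sigma,\tau}:\sigma^*\to(\sigma\to\tau^* )\to\tau^*$. Terms: constants, typed variables, applications. Conversions: $\Sigma tqr\rightsquigarrow tr(qr)$; $\Pi tq\rightsquigarrow t$; $\bigcup(\mathfrak{s}t)q\rightsquigarrow qt$; $\bigcup(\cup tq)r\rightsquigarrow\cup(\bigcup tr)(\bigcup qr)$; $R0qr\rightsquigarrow q$; $R(St)qr\rightsquigarrow r(Rtqr)t$. A one-step reduction replaces a subterm by its converse according to one conversion; reduction is a finite chain of one-step reductions. A term is normal if no one-step reduction applies to it; a normal form of $t$ is a normal term obtained from $t$ by reduction. *)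

theory Defs
  imports Main
begin

datatype ty =
    N
  | Fun ty ty  (infixr "\<rightarrow>\<^sub>t" 60)
  | Star ty

datatype const =
    Zero
  | Succ
  | Rec ty
  | Pi ty ty
  | Sigma ty ty ty
  | Sing ty
  | Cup ty
  | BigCup ty ty

fun const_ty :: "const \<Rightarrow> ty" where
  "const_ty Zero = N"
| "const_ty Succ = N \<rightarrow>\<^sub>t N"
| "const_ty (Rec \<sigma>) = N \<rightarrow>\<^sub>t \<sigma> \<rightarrow>\<^sub>t (\<sigma> \<rightarrow>\<^sub>t N \<rightarrow>\<^sub>t \<sigma>) \<rightarrow>\<^sub>t \<sigma>"
| "const_ty (Pi \<sigma> \<tau>) = \<sigma> \<rightarrow>\<^sub>t \<tau> \<rightarrow>\<^sub>t \<sigma>"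
| "const_ty (Sigma \<rho> \<sigma> \<tau>) = (\<rho> \<rightarrow>\<^sub>t \<sigma> \<rightarrow>\<^sub>t \<tau>) \<rightarrow>\<^sub>t (\<rho> \<rightarrow>\<^sub>t \<sigma>) \<rightarrow>\<^sub>t \<rho> \<rightarrow>\<^sub>t \<tau>"
| "const_ty (Sing \<sigma>) = \<sigma> \<rightarrow>\<^sub>t Star \<sigma>"
| "const_ty (Cup \<sigma>) = Star \<sigma> \<rightarrow>\<^sub>t Star \<sigma> \<rightarrow>\<^sub>t Star \<sigma>"
| "const_ty (BigCup \<sigma> \<tau>) = Star \<sigma> \<rightarrow>\<^sub>t (\<sigma> \<rightarrow>\<^sub>t Star \<tau>) \<rightarrow>\<^sub>t Star \<tau>"

text \<open>
  Applications in \<open>preterm\<close> need not be type correct; the terms of the calculus are the preterms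
  \<open>t\<close> with \<open>t \<Colon>\<^sub>t \<sigma>\<close> for some \<open>\<sigma>\<close>. Variables carry their type, so no typing context is needed.
\<close>

datatype preterm =
    Con const
  | Var nat ty
  | App preterm preterm  (infixl "\<bullet>" 70)

inductive has_type :: "preterm \<Rightarrow> ty \<Rightarrow> bool"  (infix "\<Colon>\<^sub>t" 50) where
  Con: "Con c \<Colon>\<^sub>t const_ty c"
| Var: "Var x \<sigma> \<Colon>\<^sub>t \<sigma>"
| App: "t \<Colon>\<^sub>t \<sigma> \<rightarrow>\<^sub>t \<tau> \<Longrightarrow> q \<Colon>\<^sub>t \<sigma> \<Longrightarrow> t \<bullet> q \<Colon>\<^sub>t \<tau>"

definition is_term :: "preterm \<Rightarrow> bool" where
  "is_term t \<longleftrightarrow> (\<exists>\<sigma>. t \<Colon>\<^sub>t \<sigma>)"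

inductive conv :: "preterm \<Rightarrow> preterm \<Rightarrow> bool"  (infix "\<leadsto>" 50) where
  Sigma: "Con (Sigma \<rho> \<sigma> \<tau>) \<bullet> t \<bullet> q \<bullet> r \<leadsto> t \<bullet> r \<bullet> (q \<bullet> r)"
| Pi: "Con (Pi \<sigma> \<tau>) \<bullet> t \<bullet> q \<leadsto> t"
| BigCup_Sing: "Con (BigCup \<sigma> \<tau>) \<bullet> (Con (Sing \<sigma>) \<bullet> t) \<bullet> q \<leadsto> q \<bullet> t"
| BigCup_Cup: "Con (BigCup \<sigma> \<tau>) \<bullet> (Con (Cup \<sigma>) \<bullet> t \<bullet> q) \<bullet> r
    \<leadsto> Con (Cup \<tau>) \<bullet> (Con (BigCup \<sigma> \<tau>) \<bullet> t \<bullet> r) \<bullet> (Con (BigCup \<sigma> \<tau>) \<bullet> q \<bullet> r)"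
| Rec_Zero: "Con (Rec \<sigma>) \<bullet> Con Zero \<bullet> q \<bullet> r \<leadsto> q"
| Rec_Succ: "Con (Rec \<sigma>) \<bullet> (Con Succ \<bullet> t) \<bullet> q \<bullet> r
    \<leadsto> r \<bullet> (Con (Rec \<sigma>) \<bullet> t \<bullet> q \<bullet> r) \<bullet> t"

inductive red1 :: "preterm \<Rightarrow> preterm \<Rightarrow> bool"  (infix "\<rightarrow>\<^sub>1" 50) where
  conv: "t \<leadsto> t' \<Longrightarrow> t \<rightarrow>\<^sub>1 t'"
| App_left: "t \<rightarrow>\<^sub>1 t' \<Longrightarrow> t \<bullet> q \<rightarrow>\<^sub>1 t' \<bullet> q"
| App_right: "q \<rightarrow>\<^sub>1 q' \<Longrightarrow> t \<bullet> q \<rightarrow>\<^sub>1 t \<bullet> q'"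

abbreviation reduces :: "preterm \<Rightarrow> preterm \<Rightarrow> bool"  (infix "\<rightarrow>\<^sub>1\<^sup>*" 50) where
  "t \<rightarrow>\<^sub>1\<^sup>* t' \<equiv> red1\<^sup>*\<^sup>* t t'"

definition normal :: "preterm \<Rightarrow> bool" where
  "normal t \<longleftrightarrow> \<not> (\<exists>t'. t \<rightarrow>\<^sub>1 t')"

definition normal_form_of :: "preterm \<Rightarrow> preterm \<Rightarrow> bool" where
  "normal_form_of u t \<longleftrightarrow> t \<rightarrow>\<^sub>1\<^sup>* u \<and> normal u"

text \<open>
  Reduction of a term never leaves the set of terms, so it is harmless that \<open>\<rightarrow>\<^sub>1\<close> is defined on
  all preterms.
\<close>

inductive_cases has_type_ConE [elim!]: "Con c \<Colon>\<^sub>t \<sigma>"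
inductive_cases has_type_AppE [elim!]: "t \<bullet> q \<Colon>\<^sub>t \<sigma>"

lemma conv_has_type: "t \<leadsto> t' \<Longrightarrow> t \<Colon>\<^sub>t \<sigma> \<Longrightarrow> t' \<Colon>\<^sub>t \<sigma>"
proof (induction arbitrary: \<sigma> rule: conv.induct)
  case (BigCup_Cup \<rho> \<tau> t q r)
  then have *: "t \<Colon>\<^sub>t Star \<rho>" "q \<Colon>\<^sub>t Star \<rho>" "r \<Colon>\<^sub>t \<rho> \<rightarrow>\<^sub>t Star \<tau>" "\<sigma> = Star \<tau>"
    by auto
  show ?case
    using * has_type.Con[of "Cup \<tau>"] has_type.Con[of "BigCup \<rho> \<tau>"]
    by (simp, meson has_type.App)
next
  case (Rec_Succ \<rho> t q r)
  then have *: "t \<Colon>\<^sub>t N" "q \<Colon>\<^sub>t \<rho>" "r \<Colon>\<^sub>t \<rho> \<rightarrow>\<^sub>t N \<rightarrow>\<^sub>t \<rho>" "\<sigma> = \<rho>"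
    by auto
  show ?case
    using * has_type.Con[of "Rec \<rho>"]
    by (simp, meson has_type.App)
qed (auto, (meson has_type.App)+)

lemma red1_has_type: "t \<rightarrow>\<^sub>1 t' \<Longrightarrow> t \<Colon>\<^sub>t \<sigma> \<Longrightarrow> t' \<Colon>\<^sub>t \<sigma>"
  by (induction arbitrary: \<sigma> rule: red1.induct) (auto intro: conv_has_type has_type.App)

lemma is_term_reduces: "t \<rightarrow>\<^sub>1\<^sup>* t' \<Longrightarrow> is_term t \<Longrightarrow> is_term t'"
  by (induction rule: rtranclp_induct) (auto simp: is_term_def dest: red1_has_type)

end

theory Submission
  imports Defs
begin

text \<open>
  Uniqueness: the rules are orthogonal, so parallel reduction has the triangle property (every term
  has a complete development to which all its parallel reducts reduce), whence confluence.

  Existence: Tait's computability method for weak normalisation. Computability at \<open>N\<close> and at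
  \<open>Star \<sigma>\<close> is an inductive predicate, generated by the constructors of the type, the neutral normal
  terms and closure under expansion. The recursor and \<open>\<Union>\<close> are then computable by induction on
  the computability of their first argument.
\<close>

section \<open>Confluence\<close>

lemma App_left_rtrancl: "t \<rightarrow>\<^sub>1\<^sup>* t' \<Longrightarrow> t \<bullet> q \<rightarrow>\<^sub>1\<^sup>* t' \<bullet> q"
  by (induction rule: rtranclp_induct) (auto intro: rtranclp.rtrancl_into_rtrancl red1.App_left)

lemma App_right_rtrancl: "q \<rightarrow>\<^sub>1\<^sup>* q' \<Longrightarrow> t \<bullet> q \<rightarrow>\<^sub>1\<^sup>* t \<bullet> q'"
  by (induction rule: rtranclp_induct) (auto intro: rtranclp.rtrancl_into_rtrancl red1.App_right)

lemma App_rtrancl: "t \<rightarrow>\<^sub>1\<^sup>* t' \<Longrightarrow> q \<rightarrow>\<^sub>1\<^sup>* q' \<Longrightarrow> t \<bullet> q \<rightarrow>\<^sub>1\<^sup>* t' \<bullet> q'"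
  using App_left_rtrancl App_right_rtrancl by (meson rtranclp_trans)

lemma rtrancl_conv: "t \<rightarrow>\<^sub>1\<^sup>* t' \<Longrightarrow> t' \<leadsto> u \<Longrightarrow> t \<rightarrow>\<^sub>1\<^sup>* u"
  by (meson red1.conv rtranclp.rtrancl_into_rtrancl)

section \<open>Parallel reduction\<close>

text \<open>Contracts any set of redexes already present in a term at once. The redex rules have
  premises for exactly the pieces that survive in the contractum; discarded arguments stay
  arbitrary.\<close>

inductive par :: "preterm \<Rightarrow> preterm \<Rightarrow> bool"  (infix "\<Rrightarrow>" 50) where
  Con: "Con c \<Rrightarrow> Con c"
| Var: "Var x \<sigma> \<Rrightarrow> Var x \<sigma>"
| App: "t \<Rrightarrow> t' \<Longrightarrow> q \<Rrightarrow> q' \<Longrightarrow> t \<bullet> q \<Rrightarrow> t' \<bullet> q'"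
| Sigma: "t \<Rrightarrow> t' \<Longrightarrow> q \<Rrightarrow> q' \<Longrightarrow> r \<Rrightarrow> r' \<Longrightarrow>
    Con (Sigma \<rho> \<sigma> \<tau>) \<bullet> t \<bullet> q \<bullet> r \<Rrightarrow> t' \<bullet> r' \<bullet> (q' \<bullet> r')"
| Pi: "t \<Rrightarrow> t' \<Longrightarrow> Con (Pi \<sigma> \<tau>) \<bullet> t \<bullet> q \<Rrightarrow> t'"
| BigCup_Sing: "t \<Rrightarrow> t' \<Longrightarrow> q \<Rrightarrow> q' \<Longrightarrow>
    Con (BigCup \<sigma> \<tau>) \<bullet> (Con (Sing \<sigma>) \<bullet> t) \<bullet> q \<Rrightarrow> q' \<bullet> t'"
| BigCup_Cup: "t \<Rrightarrow> t' \<Longrightarrow> q \<Rrightarrow> q' \<Longrightarrow> r \<Rrightarrow> r' \<Longrightarrow>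
    Con (BigCup \<sigma> \<tau>) \<bullet> (Con (Cup \<sigma>) \<bullet> t \<bullet> q) \<bullet> r
    \<Rrightarrow> Con (Cup \<tau>) \<bullet> (Con (BigCup \<sigma> \<tau>) \<bullet> t' \<bullet> r') \<bullet> (Con (BigCup \<sigma> \<tau>) \<bullet> q' \<bullet> r')"
| Rec_Zero: "q \<Rrightarrow> q' \<Longrightarrow> Con (Rec \<sigma>) \<bullet> Con Zero \<bullet> q \<bullet> r \<Rrightarrow> q'"
| Rec_Succ: "t \<Rrightarrow> t' \<Longrightarrow> q \<Rrightarrow> q' \<Longrightarrow> r \<Rrightarrow> r' \<Longrightarrow>
    Con (Rec \<sigma>) \<bullet> (Con Succ \<bullet> t) \<bullet> q \<bullet> r \<Rrightarrow> r' \<bullet> (Con (Rec \<sigma>) \<bullet> t' \<bullet> q' \<bullet> r') \<bullet> t'"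

text \<open>The automatic inversions concern shapes on which no conversion acts at the root, so a
  parallel step only changes their arguments. Hence the nested pattern of a redex survives steps
  inside it; this is where orthogonality enters. Shapes that may be redexes are inverted only on
  demand.\<close>

inductive_cases par_ConE [elim!]: "Con c \<Rrightarrow> u"
inductive_cases par_VarE [elim!]: "Var x \<sigma> \<Rrightarrow> u"
inductive_cases par_Con1E [elim!]: "Con c \<bullet> t \<Rrightarrow> u"
inductive_cases par_CupE [elim!]: "Con (Cup \<sigma>) \<bullet> t \<bullet> q \<Rrightarrow> u"
inductive_cases par_Rec2E [elim!]: "Con (Rec \<sigma>) \<bullet> t \<bullet> q \<Rrightarrow> u"
inductive_cases par_Sigma2E [elim!]: "Con (Sigma \<rho> \<sigma> \<tau>) \<bullet> t \<bullet> q \<Rrightarrow> u"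
inductive_cases par_SigmaE: "Con (Sigma \<rho> \<sigma> \<tau>) \<bullet> t \<bullet> q \<bullet> r \<Rrightarrow> u"
inductive_cases par_PiE: "Con (Pi \<sigma> \<tau>) \<bullet> t \<bullet> q \<Rrightarrow> u"
inductive_cases par_BigCupE: "Con (BigCup \<sigma> \<tau>) \<bullet> t \<bullet> q \<Rrightarrow> u"
inductive_cases par_RecE: "Con (Rec \<sigma>) \<bullet> t \<bullet> q \<bullet> r \<Rrightarrow> u"
inductive_cases par_AppE: "t \<bullet> q \<Rrightarrow> u"

lemma par_refl: "t \<Rrightarrow> t"
  by (induction t) (auto intro: par.intros)

lemma conv_imp_par: "t \<leadsto> u \<Longrightarrow> t \<Rrightarrow> u"
  by (induction rule: conv.induct) (auto intro: par.intros par_refl)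

lemma red1_imp_par: "t \<rightarrow>\<^sub>1 u \<Longrightarrow> t \<Rrightarrow> u"
  by (induction rule: red1.induct) (auto intro: par.App par_refl conv_imp_par)

text \<open>The pieces of a redex are reduced in place first, by congruence; one contraction at the
  root then ends the chain.\<close>

lemma par_imp_reduces: "t \<Rrightarrow> u \<Longrightarrow> t \<rightarrow>\<^sub>1\<^sup>* u"
proof (induction rule: par.induct)
  case (Pi t t' \<sigma> \<tau> q)
  then show ?case
    by - (rule rtrancl_conv[OF _ conv.Pi], (rule rtranclp.rtrancl_refl App_rtrancl | assumption)+)
next
  case (Rec_Zero q q' \<sigma> r)
  then show ?case
    by - (rule rtrancl_conv[OF _ conv.Rec_Zero], (rule rtranclp.rtrancl_refl App_rtrancl | assumption)+)
next
  case (Sigma t t' q q' r r' \<rho> \<sigma> \<tau>)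
  then show ?case
    by - (rule rtrancl_conv[OF _ conv.Sigma], (rule rtranclp.rtrancl_refl App_rtrancl | assumption)+)
next
  case (BigCup_Sing t t' q q' \<sigma> \<tau>)
  then show ?case
    by - (rule rtrancl_conv[OF _ conv.BigCup_Sing], (rule rtranclp.rtrancl_refl App_rtrancl | assumption)+)
next
  case (BigCup_Cup t t' q q' r r' \<sigma> \<tau>)
  then show ?case
    by - (rule rtrancl_conv[OF _ conv.BigCup_Cup], (rule rtranclp.rtrancl_refl App_rtrancl | assumption)+)
next
  case (Rec_Succ t t' q q' r r' \<sigma>)
  then show ?case
    by - (rule rtrancl_conv[OF _ conv.Rec_Succ], (rule rtranclp.rtrancl_refl App_rtrancl | assumption)+)
qed (simp_all add: App_rtrancl)

section \<open>Triangle property and confluence\<close>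

text \<open>The witness is the complete development of \<open>t\<close>, which contracts all its
  redexes at once. The induction is on size because a redex exposes pieces lying deeper than its
  immediate subterms.\<close>

lemma par_triangle: "\<exists>u. \<forall>v. t \<Rrightarrow> v \<longrightarrow> v \<Rrightarrow> u"
proof (induction t rule: measure_induct_rule[where f = size])
  case (less t)
  \<comment> \<open>\<open>d\<close> chooses a complete development for every smaller term, in place
    of a recursive definition.\<close>
  then obtain d where d: "\<And>s v. size s < size t \<Longrightarrow> s \<Rrightarrow> v \<Longrightarrow> v \<Rrightarrow> d s"
    by metis
  show ?case
  proof (cases "\<exists>u. t \<leadsto> u")
    case True
    then obtain u where "t \<leadsto> u" ..
    then show ?thesis
    proof cases
      case (Sigma \<rho> \<sigma> \<tau> a b c)
      \<comment> \<open>Either \<open>v\<close> has contracted the root, and congruence closes the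
        gap, or \<open>v\<close> is still a redex with reduced pieces, and the rule for that redex
        contracts it. The other redex cases follow the same pattern.\<close>
      have "v \<Rrightarrow> d a \<bullet> d c \<bullet> (d b \<bullet> d c)" if "t \<Rrightarrow> v" for v
        using that unfolding Sigma(1)
        by (auto elim!: par_SigmaE intro!: par.Sigma;
            auto intro!: par.App par.Con d[unfolded Sigma(1)])
      then show ?thesis by blast
    next
      case (Pi \<sigma> \<tau> b)
      \<comment> \<open>The contractum \<open>u\<close> is itself an argument of the redex, hence
        smaller than \<open>t\<close>, so \<open>d u\<close> is available.\<close>
      have "v \<Rrightarrow> d u" if "t \<Rrightarrow> v" for v
        using that unfolding Pi(1)
        by (auto elim!: par_PiE intro!: par.Pi;
            auto intro!: par.App par.Con d[unfolded Pi(1)])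
      then show ?thesis by blast
    next
      case (BigCup_Sing \<sigma> \<tau> a b)
      have "v \<Rrightarrow> d b \<bullet> d a" if "t \<Rrightarrow> v" for v
        using that unfolding BigCup_Sing(1)
        by (auto elim!: par_BigCupE intro!: par.BigCup_Sing;
            auto intro!: par.App par.Con d[unfolded BigCup_Sing(1)])
      then show ?thesis by blast
    next
      case (BigCup_Cup \<sigma> \<tau> a b c)
      have "v \<Rrightarrow> Con (Cup \<tau>) \<bullet> (Con (BigCup \<sigma> \<tau>) \<bullet> d a \<bullet> d c) \<bullet>
        (Con (BigCup \<sigma> \<tau>) \<bullet> d b \<bullet> d c)"
        if "t \<Rrightarrow> v" for v
        using that unfolding BigCup_Cup(1)
        by (auto elim!: par_BigCupE intro!: par.BigCup_Cup;
            auto intro!: par.App par.Con d[unfolded BigCup_Cup(1)])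
      then show ?thesis by blast
    next
      case (Rec_Zero \<sigma> c)
      have "v \<Rrightarrow> d u" if "t \<Rrightarrow> v" for v
        using that unfolding Rec_Zero(1)
        by (auto elim!: par_RecE intro!: par.Rec_Zero;
            auto intro!: par.App par.Con d[unfolded Rec_Zero(1)])
      then show ?thesis by blast
    next
      case (Rec_Succ \<sigma> a b c)
      have "v \<Rrightarrow> d c \<bullet> (Con (Rec \<sigma>) \<bullet> d a \<bullet> d b \<bullet> d c) \<bullet> d a" if "t \<Rrightarrow> v" for v
        using that unfolding Rec_Succ(1)
        by (auto elim!: par_RecE intro!: par.Rec_Succ;
            auto intro!: par.App par.Con d[unfolded Rec_Succ(1)])
      then show ?thesis by blast
    qed
  next
    case False
    show ?thesis
    proof (cases t)
      case (App a b)
      \<comment> \<open>With no redex at the root, only the congruence rule can have produced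
        \<open>v\<close>.\<close>
      have "v \<Rrightarrow> d a \<bullet> d b" if "t \<Rrightarrow> v" for v
        using that[unfolded App]
      proof cases
        case (App a' b')
        with d[of a a'] d[of b b'] \<open>t = a \<bullet> b\<close> show ?thesis by (simp add: par.App)
      qed (use False \<open>t = a \<bullet> b\<close> in \<open>auto intro: conv.intros\<close>)
      then show ?thesis by blast
    qed (auto intro: par.intros)
  qed
qed

text \<open>The triangle property closes two diverging single steps at the complete development of
  their source; such squares are tiled along the chain.\<close>

lemma par_strip: "par\<^sup>*\<^sup>* t u \<Longrightarrow> t \<Rrightarrow> v \<Longrightarrow> \<exists>w. u \<Rrightarrow> w \<and> par\<^sup>*\<^sup>* v w"
proof (induction rule: rtranclp_induct)
  case (step y z)
  then obtain w where "y \<Rrightarrow> w" "par\<^sup>*\<^sup>* v w" by blast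
  with step(2) par_triangle[of y] show ?case
    by (meson rtranclp.rtrancl_into_rtrancl)
qed auto

lemma par_confluent: "par\<^sup>*\<^sup>* t u \<Longrightarrow> par\<^sup>*\<^sup>* t v \<Longrightarrow> \<exists>w. par\<^sup>*\<^sup>* u w \<and> par\<^sup>*\<^sup>* v w"
proof (induction arbitrary: v rule: converse_rtranclp_induct)
  case (step y z)
  from par_strip[OF step(4,1)] obtain w where "v \<Rrightarrow> w" "par\<^sup>*\<^sup>* z w" by blast
  with step(3) show ?case by (meson converse_rtranclp_into_rtranclp)
qed blast

text \<open>\<open>par\<close> lies between one-step reduction and its reflexive transitive closure,
  so confluence transfers.\<close>

lemma rtrancl_par_iff: "par\<^sup>*\<^sup>* t u \<longleftrightarrow> t \<rightarrow>\<^sub>1\<^sup>* u"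
proof
  show "par\<^sup>*\<^sup>* t u \<Longrightarrow> t \<rightarrow>\<^sub>1\<^sup>* u"
    by (induction rule: rtranclp_induct) (auto dest: par_imp_reduces)
  show "t \<rightarrow>\<^sub>1\<^sup>* u \<Longrightarrow> par\<^sup>*\<^sup>* t u"
    using rtranclp_mono[of red1 par] red1_imp_par by blast
qed

theorem red1_confluent: "t \<rightarrow>\<^sub>1\<^sup>* u \<Longrightarrow> t \<rightarrow>\<^sub>1\<^sup>* v \<Longrightarrow> \<exists>w. u \<rightarrow>\<^sub>1\<^sup>* w \<and> v \<rightarrow>\<^sub>1\<^sup>* w"
  using par_confluent unfolding rtrancl_par_iff .

lemma normal_reduces_eq: "normal u \<Longrightarrow> u \<rightarrow>\<^sub>1\<^sup>* w \<Longrightarrow> w = u"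
  by (metis converse_rtranclpE normal_def)

lemma normal_form_unique: "normal_form_of u t \<Longrightarrow> normal_form_of v t \<Longrightarrow> u = v"
  unfolding normal_form_of_def by (metis red1_confluent normal_reduces_eq)

section \<open>Weak normalisation\<close>

definition wn :: "preterm \<Rightarrow> bool" where
  "wn t \<longleftrightarrow> (\<exists>u. normal_form_of u t)"

lemma wn_expand: "t \<rightarrow>\<^sub>1\<^sup>* u \<Longrightarrow> wn u \<Longrightarrow> wn t"
  unfolding wn_def normal_form_of_def by (meson rtranclp_trans)

inductive_cases red1_ConE: "Con c \<rightarrow>\<^sub>1 u"
inductive_cases red1_VarE: "Var x \<sigma> \<rightarrow>\<^sub>1 u"
inductive_cases red1_AppE: "t \<bullet> q \<rightarrow>\<^sub>1 u"
inductive_cases conv_ConE [elim!]: "Con c \<leadsto> u"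
inductive_cases conv_VarE [elim!]: "Var x \<sigma> \<leadsto> u"
inductive_cases conv_AppE: "t \<bullet> q \<leadsto> u"

lemma normal_Con: "normal (Con c)"
  by (auto simp: normal_def elim: red1_ConE)

lemma normal_Var: "normal (Var x \<sigma>)"
  by (auto simp: normal_def elim: red1_VarE)

lemma normal_App_iff: "normal (t \<bullet> q) \<longleftrightarrow> normal t \<and> normal q \<and> \<not> (\<exists>u. t \<bullet> q \<leadsto> u)"
  unfolding normal_def by (auto intro: red1.intros elim: red1_AppE)

lemma wn_Con: "wn (Con c)"
  unfolding wn_def normal_form_of_def using normal_Con by blast

text \<open>Normalising both sides separately suffices if no reduct of \<open>t\<close> can head a
  redex; this handles constants with too few arguments to fire.\<close>

lemma wn_App:
  assumes "wn t" "wn q" "\<And>t' q' u. t \<rightarrow>\<^sub>1\<^sup>* t' \<Longrightarrow> \<not> t' \<bullet> q' \<leadsto> u"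
  shows "wn (t \<bullet> q)"
proof -
  from assms(1,2) obtain t' q' where "t \<rightarrow>\<^sub>1\<^sup>* t'" "normal t'" "q \<rightarrow>\<^sub>1\<^sup>* q'" "normal q'"
    unfolding wn_def normal_form_of_def by blast
  with assms(3) have "t \<bullet> q \<rightarrow>\<^sub>1\<^sup>* t' \<bullet> q'" "normal (t' \<bullet> q')"
    by (auto simp: normal_App_iff App_rtrancl)
  then show ?thesis unfolding wn_def normal_form_of_def by blast
qed

lemma Con_reduces: "Con c \<rightarrow>\<^sub>1\<^sup>* u \<Longrightarrow> u = Con c"
  using normal_Con normal_reduces_eq by blast

text \<open>Every conversion needs at least two arguments after its head constant. Passing to
  \<open>par\<close> lets the automatic inversions do the work.\<close>

lemma Con1_reduces: "Con c \<bullet> t \<rightarrow>\<^sub>1\<^sup>* u \<Longrightarrow> \<exists>t'. u = Con c \<bullet> t'"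
  unfolding rtrancl_par_iff[symmetric] by (induction rule: rtranclp_induct) auto

lemma wn_Con1: "wn t \<Longrightarrow> wn (Con c \<bullet> t)"
  by (rule wn_App[OF wn_Con]) (auto dest!: Con_reduces elim: conv_AppE)

lemma wn_Con2:
  assumes "wn t" "wn q" "\<And>t' q' u. \<not> Con c \<bullet> t' \<bullet> q' \<leadsto> u"
  shows "wn (Con c \<bullet> t \<bullet> q)"
  using assms by (intro wn_App[OF wn_Con1]) (auto dest!: Con1_reduces)

section \<open>Neutral terms and computability\<close>

text \<open>Normal terms whose evaluation is stuck on a variable, either in head position or as the
  argument on which \<open>Rec\<close> or \<open>BigCup\<close> would branch.\<close>

inductive neutral :: "preterm \<Rightarrow> bool" where
  Var: "neutral (Var x \<sigma>)"
| App: "neutral t \<Longrightarrow> normal q \<Longrightarrow> neutral (t \<bullet> q)"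
| Rec: "neutral t \<Longrightarrow> normal q \<Longrightarrow> normal r \<Longrightarrow> neutral (Con (Rec \<sigma>) \<bullet> t \<bullet> q \<bullet> r)"
| BigCup: "neutral t \<Longrightarrow> normal q \<Longrightarrow> neutral (Con (BigCup \<sigma> \<tau>) \<bullet> t \<bullet> q)"

inductive_cases neutral_ConE [elim!]: "neutral (Con c)"
inductive_cases neutral_Con1E [elim!]: "neutral (Con c \<bullet> t)"
inductive_cases neutral_Con2E [elim!]: "neutral (Con c \<bullet> t \<bullet> q)"

text \<open>A neutral term is neither \<open>Zero\<close>, a successor, a singleton or a union, nor
  a constant awaiting its last argument, so no conversion matches around it.\<close>

lemma neutral_imp_normal: "neutral t \<Longrightarrow> normal t"
proof (induction rule: neutral.induct)
  case (App t q)
  then show ?case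
    by (auto simp: normal_App_iff elim!: conv_AppE)
qed (auto simp: normal_App_iff normal_Var normal_Con elim!: conv_AppE)

inductive compN :: "preterm \<Rightarrow> bool" where
  neutral: "neutral t \<Longrightarrow> compN t"
| Zero: "compN (Con Zero)"
| Succ: "compN t \<Longrightarrow> compN (Con Succ \<bullet> t)"
| expand: "t \<rightarrow>\<^sub>1 t' \<Longrightarrow> compN t' \<Longrightarrow> compN t"

text \<open>The parameter \<open>P\<close> stands for computability of elements, so that
  \<open>computable\<close> can recurse on types. The index \<sigma> ties \<open>Sing\<close> and
  \<open>Cup\<close> to the \<open>BigCup\<close> that can consume them. Closure under expansion
  fits weak normalisation, where one terminating path is enough.\<close>

inductive compStar :: "ty \<Rightarrow> (preterm \<Rightarrow> bool) \<Rightarrow> preterm \<Rightarrow> bool" for \<sigma> P where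
  neutral: "neutral t \<Longrightarrow> compStar \<sigma> P t"
| Sing: "P t \<Longrightarrow> compStar \<sigma> P (Con (Sing \<sigma>) \<bullet> t)"
| Cup: "compStar \<sigma> P t \<Longrightarrow> compStar \<sigma> P q \<Longrightarrow> compStar \<sigma> P (Con (Cup \<sigma>) \<bullet> t \<bullet> q)"
| expand: "t \<rightarrow>\<^sub>1 t' \<Longrightarrow> compStar \<sigma> P t' \<Longrightarrow> compStar \<sigma> P t"

text \<open>The conjunct \<open>wn t\<close> makes normalisation immediate at function types; in
  exchange, partial applications of constants must be shown to normalise.\<close>

primrec computable :: "ty \<Rightarrow> preterm \<Rightarrow> bool" where
  "computable N = compN"
| "computable (\<sigma> \<rightarrow>\<^sub>t \<tau>) = (\<lambda>t. wn t \<and> (\<forall>q. computable \<sigma> q \<longrightarrow> computable \<tau> (t \<bullet> q)))"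
| "computable (Star \<sigma>) = compStar \<sigma> (computable \<sigma>)"

lemma neutral_wn: "neutral t \<Longrightarrow> wn t"
  unfolding wn_def normal_form_of_def using neutral_imp_normal by blast

lemma compN_wn: "compN t \<Longrightarrow> wn t"
proof (induction rule: compN.induct)
  case (expand t t')
  then show ?case by (simp add: wn_expand[OF r_into_rtranclp])
qed (simp_all add: neutral_wn wn_Con wn_Con1)

lemma compStar_wn: "compStar \<sigma> P t \<Longrightarrow> (\<And>t. P t \<Longrightarrow> wn t) \<Longrightarrow> wn t"
proof (induction rule: compStar.induct)
  case (Cup t q)
  then show ?case by (intro wn_Con2) (auto elim: conv_AppE)
next
  case (expand t t')
  then show ?case by (simp add: wn_expand[OF r_into_rtranclp])
qed (simp_all add: neutral_wn wn_Con1)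

lemma computable_wn: "computable \<sigma> t \<Longrightarrow> wn t"
  by (induction \<sigma> arbitrary: t) (auto intro: compN_wn compStar_wn)

lemma computable_expand1: "t \<rightarrow>\<^sub>1 t' \<Longrightarrow> computable \<sigma> t' \<Longrightarrow> computable \<sigma> t"
proof (induction \<sigma> arbitrary: t t')
  case (Fun \<sigma> \<tau>)
  then have "wn t" using wn_expand[OF r_into_rtranclp[of red1 t t']] by simp
  moreover have "computable \<tau> (t \<bullet> q)" if "computable \<sigma> q" for q
    using Fun.prems that by (auto intro: Fun.IH(2)[OF red1.App_left])
  ultimately show ?case by simp
qed (simp_all add: compN.expand compStar.expand)

lemma computable_expand: "t \<rightarrow>\<^sub>1\<^sup>* t' \<Longrightarrow> computable \<sigma> t' \<Longrightarrow> computable \<sigma> t"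
  by (induction rule: converse_rtranclp_induct) (auto intro: computable_expand1)

lemma computable_conv: "t \<leadsto> t' \<Longrightarrow> computable \<sigma> t' \<Longrightarrow> computable \<sigma> t"
  by (rule computable_expand1[OF red1.conv])

lemma computable_neutral: "neutral t \<Longrightarrow> computable \<sigma> t"
proof (induction \<sigma> arbitrary: t)
  case (Fun \<sigma> \<tau>)
  have "computable \<tau> (t \<bullet> q)" if "computable \<sigma> q" for q
  proof -
    \<comment> \<open>A neutral application demands a normal argument, so \<open>q\<close> is
      normalised first and expansion leads back.\<close>
    from computable_wn[OF that] obtain q' where "q \<rightarrow>\<^sub>1\<^sup>* q'" "normal q'"
      unfolding wn_def normal_form_of_def by blast
    with Fun show ?thesis
      by (intro computable_expand[OF App_right_rtrancl[of q q']] Fun.IH(2) neutral.App) simp_all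
  qed
  with neutral_wn[OF Fun.prems] show ?case by simp
qed (simp_all add: compN.neutral compStar.neutral)

section \<open>Computability of the constants and of all typed terms\<close>

text \<open>Induction on the generation of \<open>compN t\<close>: a neutral \<open>t\<close> blocks
  the recursion, which is neutral once \<open>q\<close> and \<open>r\<close> are normal; for a
  successor the induction hypothesis supplies the recursive value fed to \<open>r\<close>.\<close>

lemma computable_Rec:
  assumes "compN t" "computable \<sigma> q" "computable (\<sigma> \<rightarrow>\<^sub>t N \<rightarrow>\<^sub>t \<sigma>) r"
  shows "computable \<sigma> (Con (Rec \<sigma>) \<bullet> t \<bullet> q \<bullet> r)"
  using assms(1)
proof (induction rule: compN.induct)
  case (neutral t)
  from assms(2,3)[THEN computable_wn] obtain q' r'
    where "q \<rightarrow>\<^sub>1\<^sup>* q'" "normal q'" "r \<rightarrow>\<^sub>1\<^sup>* r'" "normal r'"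
    unfolding wn_def normal_form_of_def by blast
  with neutral show ?case
    by (intro computable_expand[OF _ computable_neutral[OF neutral.Rec[of t q' r']]] App_rtrancl) auto
next
  case Zero
  show ?case using conv.Rec_Zero assms(2) by (rule computable_conv)
next
  case (Succ t)
  then show ?case
    using assms(3) by (intro computable_conv[OF conv.Rec_Succ]) simp
next
  case (expand t t')
  then show ?case by (blast intro: computable_expand1 red1.App_left red1.App_right)
qed

text \<open>Same scheme along \<open>compStar\<close>: on a singleton the function \<open>q\<close>
  is applied to a computable element, and on a union the two results are joined by
  \<open>compStar.Cup\<close>.\<close>

lemma computable_BigCup:
  assumes "compStar \<sigma> (computable \<sigma>) t" "computable (\<sigma> \<rightarrow>\<^sub>t Star \<tau>) q"
  shows "computable (Star \<tau>) (Con (BigCup \<sigma> \<tau>) \<bullet> t \<bullet> q)"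
  using assms(1)
proof (induction rule: compStar.induct)
  case (neutral t)
  from computable_wn[OF assms(2)] obtain q' where "q \<rightarrow>\<^sub>1\<^sup>* q'" "normal q'"
    unfolding wn_def normal_form_of_def by blast
  with neutral show ?case
    by (intro computable_expand[OF _ computable_neutral[OF neutral.BigCup[of t q']]] App_rtrancl) auto
next
  case (Sing t)
  then show ?case using assms(2) by (intro computable_conv[OF conv.BigCup_Sing]) simp
next
  case (Cup t r)
  then show ?case by (intro computable_conv[OF conv.BigCup_Cup]) (simp add: compStar.Cup)
next
  case (expand t t')
  then show ?case by (blast intro: computable_expand1 red1.App_left red1.App_right)
qed

lemma computable_Con: "computable (const_ty c) (Con c)"
proof (cases c)
  case Zero
  then show ?thesis by (simp add: compN.Zero)
next
  case Succ
  then show ?thesis by (simp add: compN.Succ wn_Con)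
next
  case (Rec \<sigma>)
  \<comment> \<open>\<open>Rec\<close> fires only on its third argument, so two normalisable
    arguments give a normalisable term; \<open>Sigma\<close> is treated alike below.\<close>
  have "wn (Con (Rec \<sigma>) \<bullet> t \<bullet> q)" if "compN t" "computable \<sigma> q" for t q
    using that by (intro wn_Con2) (auto intro: compN_wn computable_wn elim: conv_AppE)
  with Rec show ?thesis
    using computable_Rec by (auto simp: wn_Con intro: wn_Con1 compN_wn)
next
  case (Pi \<sigma> \<tau>)
  then show ?thesis
    by (auto simp: wn_Con intro: wn_Con1 computable_wn computable_conv[OF conv.Pi])
next
  case (Sigma \<rho> \<sigma> \<tau>)
  have "wn (Con (Sigma \<rho> \<sigma> \<tau>) \<bullet> t \<bullet> q)" if "wn t" "wn q" for t q
    using that by (intro wn_Con2) (auto elim: conv_AppE)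
  with Sigma show ?thesis
    by (auto simp: wn_Con intro: wn_Con1 computable_conv[OF conv.Sigma])
next
  case (Sing \<sigma>)
  then show ?thesis by (simp add: wn_Con compStar.Sing)
next
  case (Cup \<sigma>)
  then show ?thesis
    by (auto simp: wn_Con intro: wn_Con1 compStar.Cup compStar_wn computable_wn)
next
  case (BigCup \<sigma> \<tau>)
  have "wn t" if "compStar \<sigma> (computable \<sigma>) t" for t
    using that computable_wn[of "Star \<sigma>"] by simp
  with BigCup show ?thesis
    using computable_BigCup by (auto simp: wn_Con intro: wn_Con1)
qed

text \<open>Without binders no substitution argument arises: variables are neutral, and application
  is built into computability at function types.\<close>

lemma has_type_computable: "t \<Colon>\<^sub>t \<sigma> \<Longrightarrow> computable \<sigma> t"
  by (induction rule: has_type.induct) (auto intro: computable_Con computable_neutral neutral.Var)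

theorem theorem9:
  fixes t :: preterm
  assumes "is_term t"
  shows "\<exists>!u. normal_form_of u t"
  using assms has_type_computable computable_wn normal_form_unique
  unfolding is_term_def wn_def by blast

end
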